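(* Let $\Omega\subset\mathbb{R}^N$ be a bounded domain with $C^2$ boundary that is geometrically convex. Then $\Omega$ is (weakly) analytically convex.
   Context: A domain is a connected open set. $\Omega$ is geometrically convex if for all $P,Q\in\Omega$ the closed segment $\{(1-t)P+tQ:0\le t\le 1\}$ lies in $\Omega$. A $C^k$ function $\rho:\mathbb{R}^N\to\mathbb{R}$ is a $C^k$ defining function for $\Omega$ if $\Omega=\{x:\rho(x)<0\}$, the complement of $\overline{\Omega}$ equals $\{x:\rho(x)>0\}$, and $\nabla\rho(x)\neq 0$ for all $x\in\partial\Omega$. The domain has $C^k$ boundary if it has a $C^k$ defining function. For $P\in\partial\Omega$, $T_P(\partial\Omega)=\{w\in\mathbb{R}^N:\sum_{j=1}^N \frac{\partial\rho}{\partial x_j}(P)w_j=0\}$. A bounded domain $\Omega$ with $C^2$ boundary and $C^2$ defining function $\rho$ is (weakly) analytically convex if for every $P\in\partial\Omega$ one has $\sum_{j,k=1}^N\frac{\partial^2\rho}{\partial x_j\partial x_k}(P)w_jw_k\ge 0$ for all $w\in T_P(\partial\Omega)$ (this does not depend on the choice of $C^2$ defining function). *)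

theory Defs
  imports "HOL-Analysis.Analysis"
begin

definition domain :: "(real ^ 'n) set \<Rightarrow> bool" where
  "domain \<Omega> \<longleftrightarrow> open \<Omega> \<and> connected \<Omega>"

definition partial_deriv :: "'n \<Rightarrow> (real ^ 'n \<Rightarrow> real) \<Rightarrow> real ^ 'n \<Rightarrow> real" where
  "partial_deriv j f x = deriv (\<lambda>t. f (x + t *\<^sub>R axis j 1)) 0"

definition gradient :: "(real ^ 'n \<Rightarrow> real) \<Rightarrow> real ^ 'n \<Rightarrow> real ^ 'n" where
  "gradient f x = (\<chi> j. partial_deriv j f x)"

(* Functions of class C^k on the whole space.  In the successor case the total
   derivative exists at every point and its components are of class C^k. *)
fun Ck :: "nat \<Rightarrow> (real ^ 'n \<Rightarrow> real) \<Rightarrow> bool" where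
  "Ck 0 f \<longleftrightarrow> continuous_on UNIV f"
| "Ck (Suc k) f \<longleftrightarrow> f differentiable_on UNIV \<and> (\<forall>j. Ck k (partial_deriv j f))"

definition defining_function :: "nat \<Rightarrow> (real ^ 'n) set \<Rightarrow> (real ^ 'n \<Rightarrow> real) \<Rightarrow> bool" where
  "defining_function k \<Omega> \<rho> \<longleftrightarrow>
     Ck k \<rho> \<and> \<Omega> = {x. \<rho> x < 0} \<and> - closure \<Omega> = {x. \<rho> x > 0} \<and>
     (\<forall>x\<in>frontier \<Omega>. gradient \<rho> x \<noteq> 0)"

definition has_Ck_boundary :: "nat \<Rightarrow> (real ^ 'n) set \<Rightarrow> bool" where
  "has_Ck_boundary k \<Omega> \<longleftrightarrow> (\<exists>\<rho>. defining_function k \<Omega> \<rho>)"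

definition tangent_space :: "(real ^ 'n \<Rightarrow> real) \<Rightarrow> real ^ 'n \<Rightarrow> (real ^ 'n) set" where
  "tangent_space \<rho> P = {w. (\<Sum>j\<in>UNIV. partial_deriv j \<rho> P * w $ j) = 0}"

(* The condition on the Hessian does not depend on the choice of the defining
   function; it is required here of every one, and at least one exists. *)
definition weakly_analytically_convex :: "(real ^ 'n) set \<Rightarrow> bool" where
  "weakly_analytically_convex \<Omega> \<longleftrightarrow>
     bounded \<Omega> \<and> domain \<Omega> \<and> has_Ck_boundary 2 \<Omega> \<and>
     (\<forall>\<rho>. defining_function 2 \<Omega> \<rho> \<longrightarrow>
       (\<forall>P\<in>frontier \<Omega>. \<forall>w\<in>tangent_space \<rho> P.
         (\<Sum>j\<in>UNIV. \<Sum>k\<in>UNIV.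
            partial_deriv j (partial_deriv k \<rho>) P * w $ j * w $ k) \<ge> 0))"

end

(* Suppose the Hessian quadratic form H is negative at a tangent vector w, and let n be the
   gradient at the boundary point P.  For small e > 0 the function
   t \<mapsto> \<rho> (P + t w + e t^2 n) vanishes to first order at 0 and has second derivative
   H + 2 e |n|^2 < 0, so it is negative for small t > 0; the same holds for -w.  Hence both
   P \<plusminus> t w + e t^2 n lie in \<Omega>, and by convexity so does their midpoint P + e t^2 n.  But
   that point is displaced from P along the outward normal, where \<rho> is positive. *)
theory Submission
  imports Defs
begin

text \<open>\<open>partial_deriv\<close> is only a value of \<open>deriv\<close> along a coordinate
  line. The chain rule along \<open>x + t *\<^sub>R axis j 1\<close> identifies that value with the
  total derivative on the \<open>j\<close>-th basis vector; linearity extends this to every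
  \<open>v\<close>.\<close>

lemma has_derivative_partial_deriv:
  fixes f :: "real ^ 'n \<Rightarrow> real"
  assumes "f differentiable (at x)"
  shows "(f has_derivative (\<lambda>v. \<Sum>j\<in>UNIV. partial_deriv j f x * v $ j)) (at x)"
proof -
  obtain f' where f': "(f has_derivative f') (at x)"
    using assms by (auto simp: differentiable_def)
  then interpret bounded_linear f' by (rule has_derivative_bounded_linear)
  have partial: "f' (axis j 1) = partial_deriv j f x" for j
  proof -
    have "((\<lambda>t. x + t *\<^sub>R axis j 1) has_derivative (\<lambda>t. t *\<^sub>R axis j 1)) (at (0::real))"
      by (auto intro!: derivative_eq_intros)
    from has_derivative_compose[OF this, of f f'] f'
    have "((\<lambda>t. f (x + t *\<^sub>R axis j 1)) has_derivative (\<lambda>t. f' (t *\<^sub>R axis j 1))) (at 0)"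
      by simp
    then have "((\<lambda>t. f (x + t *\<^sub>R axis j 1)) has_real_derivative f' (axis j 1)) (at 0)"
      by (simp add: has_field_derivative_def scaleR mult.commute[of _ "f' (axis j 1)"])
    then show ?thesis
      unfolding partial_deriv_def by (simp add: DERIV_imp_deriv)
  qed
  have "f' v = (\<Sum>j\<in>UNIV. partial_deriv j f x * v $ j)" for v
  proof -
    have "v = (\<Sum>j\<in>UNIV. (v $ j) *\<^sub>R axis j 1)"
      using basis_expansion[of v] by (simp add: scalar_mult_eq_scaleR)
    then have "f' v = (\<Sum>j\<in>UNIV. f' ((v $ j) *\<^sub>R axis j 1))"
      by (metis (no_types, lifting) sum sum.cong)
    then show ?thesis
      by (simp add: scaleR partial mult.commute)
  qed
  then have "f' = (\<lambda>v. \<Sum>j\<in>UNIV. partial_deriv j f x * v $ j)"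
    by (rule ext)
  with f' show ?thesis by simp
qed

text \<open>Chain rule in coordinates. For \<open>f\<close> itself it gives the slope along a curve;
  for \<open>partial_deriv k f\<close> it supplies the Hessian terms.\<close>

lemma has_real_derivative_along_curve:
  fixes f :: "real ^ 'n \<Rightarrow> real"
  assumes "f differentiable (at (\<gamma> t))" and "(\<gamma> has_vector_derivative v) (at t)"
  shows "((\<lambda>s. f (\<gamma> s)) has_real_derivative (\<Sum>j\<in>UNIV. partial_deriv j f (\<gamma> t) * v $ j)) (at t)"
  unfolding has_field_derivative_def
  using has_derivative_compose[OF assms(2)[unfolded has_vector_derivative_def]
      has_derivative_partial_deriv[OF assms(1)]]
  by (rule has_derivative_eq_rhs) (simp add: fun_eq_iff sum_distrib_left mult_ac)

text \<open>Since \<open>g'\<close> vanishes at 0 with negative slope \<open>l\<close>, it is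
  negative just to the right of 0, and the mean value theorem passes this on to
  \<open>g\<close>.\<close>

lemma second_derivative_neg_imp_less:
  fixes g g' :: "real \<Rightarrow> real"
  assumes g: "\<And>t. (g has_real_derivative g' t) (at t)"
    and "g' 0 = 0" and g': "(g' has_real_derivative l) (at 0)" and "l < 0"
  shows "\<exists>d>0. \<forall>t. 0 < t \<and> t < d \<longrightarrow> g t < g 0"
proof -
  obtain d where d: "d > 0" "\<And>h. 0 < h \<Longrightarrow> h < d \<Longrightarrow> g' h < 0"
    using DERIV_neg_dec_right[OF g' \<open>l < 0\<close>] \<open>g' 0 = 0\<close> by auto
  have "g t < g 0" if t: "0 < t" "t < d" for t
  proof -
    obtain z where z: "0 < z" "z < t" "g t - g 0 = (t - 0) * g' z"
      using MVT2[OF t(1), of g g'] g by blast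
    moreover have "t * g' z < 0"
      using d(2)[of z] z t by (intro mult_pos_neg) auto
    ultimately show ?thesis by simp
  qed
  with d(1) show ?thesis by blast
qed

text \<open>The curve has velocity \<open>w\<close> and acceleration \<open>2 * e * n\<close> at
  \<open>P\<close>. The Hessian acts on the velocity and the gradient on the acceleration, which
  yields the two summands of \<open>neg\<close>.\<close>

lemma C2_neg_along_parabola:
  fixes f :: "real ^ 'n \<Rightarrow> real" and P :: "real ^ 'n" and e :: real
  defines "n \<equiv> gradient f P"
  assumes "Ck 2 f" and "f P = 0" and w: "w \<in> tangent_space f P"
    and neg: "(\<Sum>j\<in>UNIV. \<Sum>k\<in>UNIV. partial_deriv j (partial_deriv k f) P * w $ j * w $ k)
               + 2 * e * (n \<bullet> n) < 0"
  shows "\<exists>d>0. \<forall>t. 0 < t \<and> t < d \<longrightarrow> f (P + t *\<^sub>R w + (e * t\<^sup>2) *\<^sub>R n) < 0"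
proof -
  have diff: "f differentiable (at x)" "partial_deriv k f differentiable (at x)" for x k
    using \<open>Ck 2 f\<close> by (auto simp: numeral_2_eq_2 differentiable_on_def)
  define \<gamma> where "\<gamma> t = P + t *\<^sub>R w + (e * t\<^sup>2) *\<^sub>R n" for t
  have \<gamma>: "(\<gamma> has_vector_derivative w + (2 * e * t) *\<^sub>R n) (at t)" for t
    unfolding \<gamma>_def[abs_def] has_vector_derivative_def
    by (auto intro!: derivative_eq_intros simp: algebra_simps)
  have \<gamma>0: "\<gamma> 0 = P" by (simp add: \<gamma>_def)
  define g' where
    "g' t = (\<Sum>k\<in>UNIV. partial_deriv k f (\<gamma> t) * (w + (2 * e * t) *\<^sub>R n) $ k)" for t
  have "((\<lambda>s. f (\<gamma> s)) has_real_derivative g' t) (at t)" for t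
    unfolding g'_def by (rule has_real_derivative_along_curve[OF diff(1) \<gamma>])
  \<comment> \<open>At time 0 the slope is the gradient paired with \<open>w\<close>, which is zero
    by tangency.\<close>
  moreover have "g' 0 = 0"
    using w by (simp add: g'_def \<gamma>0 tangent_space_def)
  moreover have "(g' has_real_derivative
      (\<Sum>k\<in>UNIV. (\<Sum>j\<in>UNIV. partial_deriv j (partial_deriv k f) P * w $ j) * w $ k
        + 2 * e * n $ k * partial_deriv k f P)) (at 0)"
  proof -
    have "((\<lambda>t. partial_deriv k f (\<gamma> t)) has_real_derivative
        (\<Sum>j\<in>UNIV. partial_deriv j (partial_deriv k f) P * w $ j)) (at 0)" for k
      using has_real_derivative_along_curve[OF diff(2) \<gamma>, of k 0] by (simp add: \<gamma>0)
    moreover have "((\<lambda>t. (w + (2 * e * t) *\<^sub>R n) $ k) has_real_derivative 2 * e * n $ k) (at 0)" for k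
      by (auto intro!: derivative_eq_intros)
    ultimately have "((\<lambda>t. partial_deriv k f (\<gamma> t) * (w + (2 * e * t) *\<^sub>R n) $ k) has_real_derivative
        (\<Sum>j\<in>UNIV. partial_deriv j (partial_deriv k f) P * w $ j) * (w + (2 * e * 0) *\<^sub>R n) $ k
          + 2 * e * n $ k * partial_deriv k f (\<gamma> 0)) (at 0)" for k
      by (rule DERIV_mult)
    then show ?thesis
      unfolding g'_def[abs_def] by (intro DERIV_sum) (simp add: \<gamma>0)
  qed
  moreover have "(\<Sum>k\<in>UNIV. (\<Sum>j\<in>UNIV. partial_deriv j (partial_deriv k f) P * w $ j) * w $ k
        + 2 * e * n $ k * partial_deriv k f P) < 0"
  proof -
    \<comment> \<open>Differentiating \<open>g'\<close> leaves the sum over \<open>k\<close>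
      outermost, while \<open>neg\<close> has \<open>j\<close> outermost.\<close>
    have "(\<Sum>k\<in>UNIV. (\<Sum>j\<in>UNIV. partial_deriv j (partial_deriv k f) P * w $ j) * w $ k)
        = (\<Sum>j\<in>UNIV. \<Sum>k\<in>UNIV. partial_deriv j (partial_deriv k f) P * w $ j * w $ k)"
      unfolding sum_distrib_right by (rule sum.swap)
    moreover have "(\<Sum>k\<in>UNIV. 2 * e * n $ k * partial_deriv k f P) = 2 * e * (n \<bullet> n)"
      by (simp add: n_def gradient_def inner_vec_def sum_distrib_left mult.assoc)
    ultimately show ?thesis
      using neg by (simp add: sum.distrib)
  qed
  ultimately have "\<exists>d>0. \<forall>t. 0 < t \<and> t < d \<longrightarrow> f (\<gamma> t) < f (\<gamma> 0)"
    by (rule second_derivative_neg_imp_less)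
  then show ?thesis
    using \<open>f P = 0\<close> by (simp add: \<gamma>0) (simp add: \<gamma>_def)
qed

text \<open>The slope of \<open>f\<close> at \<open>P\<close> in the direction of its own gradient
  is the squared norm of the gradient, hence positive.\<close>

lemma pos_along_gradient:
  fixes f :: "real ^ 'n \<Rightarrow> real"
  assumes "f differentiable (at P)" and "gradient f P \<noteq> 0"
  shows "\<exists>d>0. \<forall>s. 0 < s \<and> s < d \<longrightarrow> f P < f (P + s *\<^sub>R gradient f P)"
proof -
  let ?n = "gradient f P"
  have "((\<lambda>s. P + s *\<^sub>R ?n) has_vector_derivative ?n) (at 0)"
    unfolding has_vector_derivative_def by (auto intro!: derivative_eq_intros)
  then have "((\<lambda>s. f (P + s *\<^sub>R ?n)) has_real_derivative ?n \<bullet> ?n) (at 0)"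
    using has_real_derivative_along_curve[of f "\<lambda>s. P + s *\<^sub>R ?n" 0 ?n] assms(1)
    by (simp add: gradient_def inner_vec_def)
  from DERIV_pos_inc_right[OF this] assms(2) show ?thesis by auto
qed

text \<open>A frontier point of an open set lies outside the set but inside its closure, so both
  strict signs of \<rho> are excluded.\<close>

lemma defining_function_eq_0_frontier:
  assumes "defining_function k \<Omega> \<rho>" and "open \<Omega>" and "P \<in> frontier \<Omega>"
  shows "\<rho> P = 0"
proof -
  have "P \<notin> \<Omega>" "P \<notin> - closure \<Omega>"
    using assms(2,3) by (auto simp: frontier_def interior_open)
  then show ?thesis
    using assms(1) unfolding defining_function_def
    by (metis mem_Collect_eq linorder_less_linear)
qed

text \<open>The function \<rho> is arbitrary here because \<open>weakly_analytically_convex\<close>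
  quantifies over all defining functions.\<close>

lemma convex_imp_Hessian_nonneg:
  fixes \<Omega> :: "(real ^ 'n) set"
  assumes "open \<Omega>" and "convex \<Omega>" and \<rho>: "defining_function 2 \<Omega> \<rho>"
    and P: "P \<in> frontier \<Omega>" and w: "w \<in> tangent_space \<rho> P"
  shows "(\<Sum>j\<in>UNIV. \<Sum>k\<in>UNIV. partial_deriv j (partial_deriv k \<rho>) P * w $ j * w $ k) \<ge> 0"
    (is "?H w \<ge> 0")
proof (rule ccontr)
  assume "\<not> ?H w \<ge> 0"
  then have H: "?H w < 0" by simp
  define n where "n = gradient \<rho> P"
  have C2: "Ck 2 \<rho>" and \<Omega>: "\<Omega> = {x. \<rho> x < 0}" and n: "n \<noteq> 0"
    using \<rho> P by (auto simp: defining_function_def n_def)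
  have P0: "\<rho> P = 0"
    using defining_function_eq_0_frontier[OF \<rho> \<open>open \<Omega>\<close> P] .
  \<comment> \<open>With this choice \<open>2 * e * (n \<bullet> n)\<close> is half of
    \<open>- ?H w\<close>, so the second derivative along the parabola is
    \<open>?H w / 2\<close>.\<close>
  define e where "e = - ?H w / (4 * (n \<bullet> n))"
  have e: "e > 0" and neg: "?H w + 2 * e * (n \<bullet> n) < 0"
    using H n by (auto simp: e_def field_simps)
  \<comment> \<open>The tangent space is symmetric and the quadratic form is even, so the same
    \<open>e\<close> serves both parabolas.\<close>
  have w': "- w \<in> tangent_space \<rho> P" and neg': "?H (- w) + 2 * e * (n \<bullet> n) < 0"
    using w neg by (auto simp: tangent_space_def sum_negf)
  obtain d1 where d1: "d1 > 0"
    "\<And>t. 0 < t \<Longrightarrow> t < d1 \<Longrightarrow> \<rho> (P + t *\<^sub>R w + (e * t\<^sup>2) *\<^sub>R n) < 0"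
    using C2_neg_along_parabola[OF C2 P0 w neg[unfolded n_def]] unfolding n_def by blast
  obtain d2 where d2: "d2 > 0"
    "\<And>t. 0 < t \<Longrightarrow> t < d2 \<Longrightarrow> \<rho> (P + t *\<^sub>R (- w) + (e * t\<^sup>2) *\<^sub>R n) < 0"
    using C2_neg_along_parabola[OF C2 P0 w' neg'[unfolded n_def]] unfolding n_def by blast
  have "\<rho> differentiable (at P)"
    using C2 by (auto simp: numeral_2_eq_2 differentiable_on_def)
  then obtain d3 where d3: "d3 > 0" "\<And>s. 0 < s \<Longrightarrow> s < d3 \<Longrightarrow> 0 < \<rho> (P + s *\<^sub>R n)"
    using pos_along_gradient[of \<rho> P] n P0 unfolding n_def by auto
  \<comment> \<open>The bound 1 makes \<open>t\<^sup>2 < t\<close>, so that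
    \<open>t < d3 / e\<close> also keeps the normal displacement \<open>e * t\<^sup>2\<close> below
    \<open>d3\<close>.\<close>
  have "0 < Min {d1, d2, 1, d3 / e}"
    using d1(1) d2(1) d3(1) e by simp
  then obtain t where "0 < t" "t < Min {d1, d2, 1, d3 / e}"
    using dense by blast
  then have t: "0 < t" "t < d1" "t < d2" "t < 1" "t < d3 / e"
    by simp_all
  have "t\<^sup>2 < d3 / e"
    using t mult_strict_left_mono[of t 1 t] unfolding power2_eq_square by linarith
  then have et: "e * t\<^sup>2 < d3"
    using e by (simp add: field_simps)
  have "P + t *\<^sub>R w + (e * t\<^sup>2) *\<^sub>R n \<in> \<Omega>" "P + t *\<^sub>R (- w) + (e * t\<^sup>2) *\<^sub>R n \<in> \<Omega>"
    using d1(2) d2(2) t \<Omega> by auto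
  from convexD[OF \<open>convex \<Omega>\<close> this, of "1/2" "1/2"]
  have "(1/2) *\<^sub>R (P + t *\<^sub>R w + (e * t\<^sup>2) *\<^sub>R n) +
      (1/2) *\<^sub>R (P + t *\<^sub>R (- w) + (e * t\<^sup>2) *\<^sub>R n) \<in> \<Omega>"
    by simp
  also have "(1/2) *\<^sub>R (P + t *\<^sub>R w + (e * t\<^sup>2) *\<^sub>R n) +
      (1/2) *\<^sub>R (P + t *\<^sub>R (- w) + (e * t\<^sup>2) *\<^sub>R n) = P + (e * t\<^sup>2) *\<^sub>R n"
    by (simp add: vec_eq_iff field_simps)
  finally have "P + (e * t\<^sup>2) *\<^sub>R n \<in> \<Omega>" .
  moreover have "0 < \<rho> (P + (e * t\<^sup>2) *\<^sub>R n)"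
    using d3(2) et e t by simp
  ultimately show False
    using \<Omega> by auto
qed

theorem proposition7:
  fixes \<Omega> :: "(real ^ 'n) set"
  assumes "bounded \<Omega>"
    and "domain \<Omega>"
    and "has_Ck_boundary 2 \<Omega>"
    and "convex \<Omega>"
  shows "weakly_analytically_convex \<Omega>"
  using assms convex_imp_Hessian_nonneg
  unfolding weakly_analytically_convex_def domain_def by blast

end
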